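(* Consider the control-affine system $\dot{\mathbf x}=\mathbf f(\mathbf x)+\mathbf g(\mathbf x)\mathbf u$ with $\mathbf x\in\mathbb R^n$, $\mathbf u\in\mathbb R^m$, and smooth $\mathbf f:\mathbb R^n\to\mathbb R^n$, $\mathbf g:\mathbb R^n\to\mathbb R^{n\times m}$. Let $\mathbf H:\mathbb R^n\to\mathbb S^p$ be smooth, with associated functions $\boldsymbol\Psi_1,\dots,\boldsymbol\Psi_r$ and sets $\mathcal C_i=\{\mathbf x\in\mathbb R^n : \boldsymbol\Psi_i(\mathbf x)\succeq \mathbf 0\}$, $i\in\{1,\dots,r\}$, as defined in the context. If $\mathbf H$ is a high-order matrix control barrier function (HOMCBF) for the system, with $\alpha_r$ the extended class-$\mathcal K^e$ function in the HOMCBF condition, then any continuous feedback controller $\mathbf k:\mathbb R^n\to\mathbb R^m$ satisfying $$\dot{\boldsymbol\Psi}_r(\mathbf x,\mathbf k(\mathbf x))\succeq-\boldsymbol\alpha_r(\boldsymbol\Psi_r(\mathbf x))$$ for all $\mathbf x$ in an open neighborhood of $\bigcap_{i=1}^r\mathcal C_i$ renders the intersection $\bigcap_{i=1}^r\mathcal C_i$ forward invariant for the closed-loop system under the state feedback $\mathbf u=\mathbf k(\mathbf x)$. In particular, given a nominal controller $\mathbf x\mapsto\mathbf k_{\rm nom}(\mathbf x)\in\mathbb R^m$, the controller $$\mathbf k(\mathbf x)=\arg\min_{\mathbf u\in\mathbb R^m}\ \|\mathbf u-\mathbf k_{\rm nom}(\mathbf x)\|^2\quad\text{s.t.}\quad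 \dot{\boldsymbol\Psi}_r(\mathbf x,\mathbf u)\succeq-\boldsymbol\alpha_r(\boldsymbol\Psi_r(\mathbf x))$$ is continuous on an open neighborhood of $\bigcap_{i=1}^r\mathcal C_i$, and therefore renders the intersection $\bigcap_{i=1}^r\mathcal C_i$ forward invariant for the closed-loop system.
   Context: $\mathbb S^p$ is the set of real symmetric $p\times p$ matrices; $\succeq$, $\succ$ denote the positive semidefinite / positive definite ordering. $\mathbf g_j$ is the $j$-th column of $\mathbf g$. Matrix Lie derivative: for $\mathbf A:\mathbb R^n\to\mathbb S^p$ and a vector field $\mathbf w$, $\mathbf L_{\mathbf w}\mathbf A(\mathbf x)$ is the matrix with entries $\nabla A_{ij}(\mathbf x)^\top\mathbf w(\mathbf x)$. Extended class-$\mathcal K^e$ function: a continuous, strictly increasing $\alpha:\mathbb R\to\mathbb R$ with $\alpha(0)=0$. The bold $\boldsymbol\alpha:\mathbb S^p\to\mathbb S^p$ is defined spectrally from $\alpha$: $\boldsymbol\alpha(Q\,\mathrm{diag}(\lambda_1,\dots,\lambda_p)Q^\top)=Q\,\mathrm{diag}(\alpha(\lambda_1),\dots,\alpha(\lambda_p))Q^\top$ for $Q$ orthogonal. Recursive functions: with extended class-$\mathcal K^e$ functions $\alpha_1,\dots,\alpha_{r-1}$, set $\boldsymbol\Psi_1=\mathbf H$ and $\boldsymbol\Psi_{i+1}(\mathbf x)=\mathbf L_{\mathbf f}\boldsymbol\Psi_i(\mathbf x)+\boldsymbol\alpha_i(\boldsymbol\Psi_i(\mathbf x))$ for $i\in\{1,\dots,r-1\}$.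 Here $r\in\mathbb N$ is the first level for which there exists $j\in\{1,\dots,m\}$ such that $\mathbf L_{\mathbf g_j}\boldsymbol\Psi_r\not\equiv\mathbf 0$. Notation: $\dot{\boldsymbol\Psi}_r(\mathbf x,\mathbf u)=\mathbf L_{\mathbf f}\boldsymbol\Psi_r(\mathbf x)+\sum_{j=1}^m\mathbf L_{\mathbf g_j}\boldsymbol\Psi_r(\mathbf x)\,u_j$. HOMCBF: $\mathbf H$ is a high-order matrix control barrier function for the system if there exists an extended class-$\mathcal K^e$ function $\alpha_r$ such that for each $\mathbf x\in\bigcap_{i=1}^r\mathcal C_i$ there exists $\mathbf u\in\mathbb R^m$ with $\dot{\boldsymbol\Psi}_r(\mathbf x,\mathbf u)\succ-\boldsymbol\alpha_r(\boldsymbol\Psi_r(\mathbf x))$. Forward invariance: a set is forward invariant for the closed-loop system if trajectories starting in the set remain in it for all time $t\ge0$.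
   Formalization: Two assumptions are added: the functions Ψ_1,…,Ψ_r are continuously differentiable (otherwise the Lie derivatives may not exist or the optimal controller may jump), and the nominal controller k_nom is continuous (otherwise k = k_nom is discontinuous where the constraint is inactive). *)

theory Defs
  imports "HOL-Analysis.Analysis"
begin

text \<open>
  \<open>C_k k F\<close>: the map \<open>F\<close> is \<open>k\<close> times continuously differentiable on the whole space.  In finite
  dimension, continuity of all directional derivatives \<open>x \<mapsto> DF(x) v\<close> amounts to continuity of \<open>DF\<close>.
\<close>

primrec C_k :: "nat \<Rightarrow> ('a::euclidean_space \<Rightarrow> 'b::euclidean_space) \<Rightarrow> bool" where
  "C_k 0 F \<longleftrightarrow> continuous_on UNIV F"
| "C_k (Suc k) F \<longleftrightarrow>
     (\<forall>x. F differentiable (at x)) \<and> (\<forall>v. C_k k (\<lambda>x. frechet_derivative F (at x) v))"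

definition smooth :: "('a::euclidean_space \<Rightarrow> 'b::euclidean_space) \<Rightarrow> bool" where
  "smooth F \<longleftrightarrow> (\<forall>k. C_k k F)"


definition symmetric :: "real^'p^'p \<Rightarrow> bool" where
  "symmetric A \<longleftrightarrow> transpose A = A"

definition pos_semidef :: "real^'p^'p \<Rightarrow> bool" where
  "pos_semidef A \<longleftrightarrow> symmetric A \<and> (\<forall>v. 0 \<le> v \<bullet> (A *v v))"

definition pos_def :: "real^'p^'p \<Rightarrow> bool" where
  "pos_def A \<longleftrightarrow> symmetric A \<and> (\<forall>v. v \<noteq> 0 \<longrightarrow> 0 < v \<bullet> (A *v v))"

definition loewner_le :: "real^'p^'p \<Rightarrow> real^'p^'p \<Rightarrow> bool" (infix "\<preceq>" 50) where
  "A \<preceq> B \<longleftrightarrow> pos_semidef (B - A)"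

definition loewner_less :: "real^'p^'p \<Rightarrow> real^'p^'p \<Rightarrow> bool" (infix "\<prec>" 50) where
  "A \<prec> B \<longleftrightarrow> pos_def (B - A)"


definition class_Ke :: "(real \<Rightarrow> real) \<Rightarrow> bool" where
  "class_Ke a \<longleftrightarrow> continuous_on UNIV a \<and> strict_mono a \<and> a 0 = 0"

definition diag :: "real^'p \<Rightarrow> real^'p^'p" where
  "diag d = (\<chi> i j. if i = j then d $ i else 0)"

definition spectral :: "(real \<Rightarrow> real) \<Rightarrow> real^'p^'p \<Rightarrow> real^'p^'p" where
  "spectral a A = (THE B. \<exists>Q d. orthogonal_matrix Q \<and> A = Q ** diag d ** transpose Q \<and>
                          B = Q ** diag (\<chi> i. a (d $ i)) ** transpose Q)"

text \<open>The value does not depend on the chosen diagonalization, so the description is proper.\<close>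

lemma diag_mult_right: "(W ** diag d) $ i $ j = W $ i $ j * d $ j"
  by (simp add: matrix_matrix_mult_def diag_def if_distrib[of "\<lambda>z. _ * z"] cong: if_cong)

lemma diag_mult_left: "(diag d ** W) $ i $ j = d $ i * W $ i $ j"
  by (simp add: matrix_matrix_mult_def diag_def if_distrib[of "\<lambda>z. z * _"] cong: if_cong)

lemma spectral_unique:
  fixes Q R :: "real^'p^'p"
  assumes Q: "orthogonal_matrix Q" and R: "orthogonal_matrix R"
    and eq: "Q ** diag d ** transpose Q = R ** diag e ** transpose R"
  shows "Q ** diag (\<chi> i. a (d $ i)) ** transpose Q = R ** diag (\<chi> i. a (e $ i)) ** transpose R"
proof -
  define W where "W = transpose R ** Q"
  have Q1: "transpose Q ** Q = mat 1" "Q ** transpose Q = mat 1"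
    and R1: "transpose R ** R = mat 1" "R ** transpose R = mat 1"
    using Q R by (auto simp: orthogonal_matrix_def)
  have RW: "R ** W = Q"
    by (simp add: W_def matrix_mul_assoc R1)
  have WQ: "W ** transpose Q = transpose R"
    by (simp add: W_def Q1 flip: matrix_mul_assoc)
  have "W ** diag d = transpose R ** (Q ** diag d ** transpose Q) ** Q"
    by (simp add: W_def Q1 flip: matrix_mul_assoc)
  also have "\<dots> = diag e ** W"
    unfolding eq by (simp add: W_def R1 matrix_mul_assoc)
  finally have "(W ** diag d) $ i $ j = (diag e ** W) $ i $ j" for i j
    by simp
  then have entry: "W $ i $ j * d $ j = e $ i * W $ i $ j" for i j
    by (simp add: diag_mult_right diag_mult_left)
  have "W $ i $ j * a (d $ j) = a (e $ i) * W $ i $ j" for i j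
    using entry[of i j] by (cases "W $ i $ j = 0") auto
  then have "W ** diag (\<chi> i. a (d $ i)) = diag (\<chi> i. a (e $ i)) ** W"
    by (simp add: vec_eq_iff diag_mult_right diag_mult_left)
  then have "R ** (W ** diag (\<chi> i. a (d $ i))) ** transpose Q
      = R ** (diag (\<chi> i. a (e $ i)) ** W) ** transpose Q"
    by simp
  then show ?thesis
    by (metis RW WQ matrix_mul_assoc)
qed

lemma spectral_eq:
  fixes Q :: "real^'p^'p"
  assumes "orthogonal_matrix Q"
  shows "spectral a (Q ** diag d ** transpose Q) = Q ** diag (\<chi> i. a (d $ i)) ** transpose Q"
  unfolding spectral_def
proof (rule the_equality)
  show "\<exists>R e. orthogonal_matrix R \<and> Q ** diag d ** transpose Q = R ** diag e ** transpose R \<and>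
      Q ** diag (\<chi> i. a (d $ i)) ** transpose Q = R ** diag (\<chi> i. a (e $ i)) ** transpose R"
    using assms by blast
next
  fix B
  assume "\<exists>R e. orthogonal_matrix R \<and> Q ** diag d ** transpose Q = R ** diag e ** transpose R \<and>
      B = R ** diag (\<chi> i. a (e $ i)) ** transpose R"
  then show "B = Q ** diag (\<chi> i. a (d $ i)) ** transpose Q"
    using spectral_unique[OF assms] by metis
qed


definition gradient :: "(real^'n \<Rightarrow> real) \<Rightarrow> real^'n \<Rightarrow> real^'n" where
  "gradient \<phi> x = (THE D. GDERIV \<phi> x :> D)"

definition Lie :: "(real^'n \<Rightarrow> real^'n) \<Rightarrow> (real^'n \<Rightarrow> real^'p^'p) \<Rightarrow> real^'n \<Rightarrow> real^'p^'p" where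
  "Lie w A x = (\<chi> i j. gradient (\<lambda>y. A y $ i $ j) x \<bullet> w x)"

text \<open>
  Levels are counted from \<open>1\<close>: \<open>Psi f H \<alpha> 1 = H\<close>, and \<open>\<alpha> i\<close> is used to pass from level \<open>i\<close> to
  level \<open>i + 1\<close>.  Index \<open>0\<close> is never used.
\<close>

primrec Psi :: "(real^'n \<Rightarrow> real^'n) \<Rightarrow> (real^'n \<Rightarrow> real^'p^'p) \<Rightarrow> (nat \<Rightarrow> real \<Rightarrow> real)
    \<Rightarrow> nat \<Rightarrow> real^'n \<Rightarrow> real^'p^'p" where
  "Psi f H \<alpha> 0 = H"
| "Psi f H \<alpha> (Suc i) =
     (if i = 0 then H
      else (\<lambda>x. Lie f (Psi f H \<alpha> i) x + spectral (\<alpha> i) (Psi f H \<alpha> i x)))"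

definition safe_set :: "(real^'n \<Rightarrow> real^'n) \<Rightarrow> (real^'n \<Rightarrow> real^'p^'p) \<Rightarrow> (nat \<Rightarrow> real \<Rightarrow> real)
    \<Rightarrow> nat \<Rightarrow> (real^'n) set" where
  "safe_set f H \<alpha> i = {x. 0 \<preceq> Psi f H \<alpha> i x}"

definition first_actuated_level :: "(real^'n \<Rightarrow> real^'n) \<Rightarrow> (real^'n \<Rightarrow> real^'m^'n)
    \<Rightarrow> (real^'n \<Rightarrow> real^'p^'p) \<Rightarrow> (nat \<Rightarrow> real \<Rightarrow> real) \<Rightarrow> nat \<Rightarrow> bool" where
  "first_actuated_level f g H \<alpha> r \<longleftrightarrow>
     1 \<le> r \<and>
     (\<exists>j x. Lie (\<lambda>y. column j (g y)) (Psi f H \<alpha> r) x \<noteq> 0) \<and>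
     (\<forall>i\<in>{1..<r}. \<forall>j x. Lie (\<lambda>y. column j (g y)) (Psi f H \<alpha> i) x = 0)"

definition Psi_dot :: "(real^'n \<Rightarrow> real^'n) \<Rightarrow> (real^'n \<Rightarrow> real^'m^'n)
    \<Rightarrow> (real^'n \<Rightarrow> real^'p^'p) \<Rightarrow> (nat \<Rightarrow> real \<Rightarrow> real) \<Rightarrow> nat \<Rightarrow> real^'n \<Rightarrow> real^'m \<Rightarrow> real^'p^'p" where
  "Psi_dot f g H \<alpha> r x u =
     Lie f (Psi f H \<alpha> r) x
     + (\<Sum>j\<in>UNIV. u $ j *\<^sub>R Lie (\<lambda>y. column j (g y)) (Psi f H \<alpha> r) x)"

text \<open>\<open>H\<close> is a high-order matrix control barrier function, witnessed by \<open>\<alpha>\<^sub>r = ar\<close>.\<close>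

definition HOMCBF_with :: "(real^'n \<Rightarrow> real^'n) \<Rightarrow> (real^'n \<Rightarrow> real^'m^'n)
    \<Rightarrow> (real^'n \<Rightarrow> real^'p^'p) \<Rightarrow> (nat \<Rightarrow> real \<Rightarrow> real) \<Rightarrow> nat \<Rightarrow> (real \<Rightarrow> real) \<Rightarrow> bool" where
  "HOMCBF_with f g H \<alpha> r ar \<longleftrightarrow>
     class_Ke ar \<and>
     (\<forall>x\<in>(\<Inter>i\<in>{1..r}. safe_set f H \<alpha> i).
        \<exists>u. - spectral ar (Psi f H \<alpha> r x) \<prec> Psi_dot f g H \<alpha> r x u)"


definition trajectory :: "(real^'n \<Rightarrow> real^'n) \<Rightarrow> real set \<Rightarrow> (real \<Rightarrow> real^'n) \<Rightarrow> bool" where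
  "trajectory F J x \<longleftrightarrow> (\<forall>t\<in>J. (x has_vector_derivative F (x t)) (at t within J))"

text \<open>
  Solutions need neither be unique nor exist globally: every solution starting in \<open>S\<close> has to stay in
  \<open>S\<close> on its whole interval of existence in forward time.
\<close>

definition forward_invariant :: "(real^'n \<Rightarrow> real^'n) \<Rightarrow> (real^'n) set \<Rightarrow> bool" where
  "forward_invariant F S \<longleftrightarrow>
     (\<forall>J x. is_interval J \<and> 0 \<in> J \<and> J \<subseteq> {0..} \<and> trajectory F J x \<and> x 0 \<in> S
        \<longrightarrow> (\<forall>t\<in>J. x t \<in> S))"

definition closed_loop :: "(real^'n \<Rightarrow> real^'n) \<Rightarrow> (real^'n \<Rightarrow> real^'m^'n)
    \<Rightarrow> (real^'n \<Rightarrow> real^'m) \<Rightarrow> real^'n \<Rightarrow> real^'n" where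
  "closed_loop f g k x = f x + g x *v k x"

end

theory Submission
  imports Defs
begin

text \<open>
  Invariance is a last-exit argument. After the last time in the intersection the trajectory stays in
  the given neighbourhood for a while, and there \<open>\<Psi>\<^sub>r' \<succeq> - \<alpha>\<^sub>r(\<Psi>\<^sub>r)\<close>. A matrix comparison principle,
  proved by minimising \<open>v \<bullet> \<Psi>\<^sub>r(x(t)) v\<close> jointly over time and unit vectors, keeps \<open>\<Psi>\<^sub>r\<close> positive
  semidefinite. For \<open>i < r\<close> the input does not enter, so
  \<open>\<Psi>\<^sub>i' = \<Psi>\<^sub>i\<^sub>+\<^sub>1 - \<alpha>\<^sub>i(\<Psi>\<^sub>i)\<close>, and the same principle descends from level \<open>i + 1\<close> to level \<open>i\<close>.

  For the quadratic program, let \<open>U\<close> be the set of states with a strictly feasible input: it is open and,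
  by the HOMCBF condition, contains the intersection. On \<open>U\<close> the feasible set is closed, convex and
  nonempty, and the graph of the minimiser is closed, which together with local boundedness gives
  continuity.
\<close>

section \<open>Symmetric matrices and the spectral calculus\<close>

lemma continuous_on_matrix_vector_mult [continuous_intros]:
  fixes A :: "'a::topological_space \<Rightarrow> real^'n^'m"
  assumes "continuous_on S A" "continuous_on S v"
  shows "continuous_on S (\<lambda>x. A x *v v x)"
  unfolding matrix_vector_mult_def by (intro continuous_intros assms)

lemma continuous_on_matrix_matrix_mult [continuous_intros]:
  fixes A :: "'a::topological_space \<Rightarrow> real^'n^'m" and B :: "'a \<Rightarrow> real^'k^'n"
  assumes "continuous_on S A" "continuous_on S B"
  shows "continuous_on S (\<lambda>x. A x ** B x)"
  unfolding matrix_matrix_mult_def by (intro continuous_intros assms)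

lemma continuous_on_transpose [continuous_intros]:
  fixes A :: "'a::topological_space \<Rightarrow> real^'n^'m"
  assumes "continuous_on S A"
  shows "continuous_on S (\<lambda>x. transpose (A x))"
  unfolding transpose_def by (intro continuous_intros assms)

lemma continuous_on_diag [continuous_intros]:
  assumes "continuous_on S d"
  shows "continuous_on S (\<lambda>x. diag (d x))"
proof -
  have "continuous_on S (\<lambda>x. if i = j then d x $ i else 0)" for i j :: 'b
    using assms by (cases "i = j") (auto intro: continuous_intros)
  then show ?thesis
    unfolding diag_def by (intro continuous_intros)
qed

section \<open>Symmetric matrices and orthogonal diagonalization\<close>

lemma symmetric_dot:
  fixes A :: "real^'p^'p"
  assumes "symmetric A"
  shows "u \<bullet> (A *v w) = w \<bullet> (A *v u)"
  by (metis assms dot_lmul_matrix inner_commute symmetric_def transpose_matrix_vector)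

lemma symmetric_iff_nth: "symmetric A \<longleftrightarrow> (\<forall>i j. A $ i $ j = A $ j $ i)"
  by (auto simp: symmetric_def transpose_def vec_eq_iff)

lemma symmetric_add: "symmetric A \<Longrightarrow> symmetric B \<Longrightarrow> symmetric (A + B)"
  by (simp add: symmetric_iff_nth)

lemma symmetric_scaleR: "symmetric A \<Longrightarrow> symmetric (c *\<^sub>R A)"
  by (simp add: symmetric_iff_nth)

lemma symmetric_sum: "(\<And>i. i \<in> I \<Longrightarrow> symmetric (A i)) \<Longrightarrow> symmetric (\<Sum>i\<in>I. A i)"
  by (simp add: symmetric_iff_nth)

text \<open>First variation: the form \<open>q\<close> of A - \<mu> I is nonnegative on
  \<open>V\<close> and vanishes at \<open>v\<close>, so pairing \<open>v\<close> with the residual A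
  v - \<mu> v must give 0; but this pairing is the squared norm of the residual. Invariant subspaces
  are allowed because diagonalization uses orthogonal complements, while the comparison principle
  uses the whole space.\<close>

lemma eigenvector_of_minimal_quadratic_form:
  fixes A :: "real^'p^'p"
  assumes sym: "symmetric A" and V: "subspace V" and inv: "\<And>u. u \<in> V \<Longrightarrow> A *v u \<in> V"
    and v: "v \<in> V" "norm v = 1"
    and min: "\<And>u. u \<in> V \<Longrightarrow> norm u = 1 \<Longrightarrow> v \<bullet> (A *v v) \<le> u \<bullet> (A *v u)"
  shows "A *v v = (v \<bullet> (A *v v)) *\<^sub>R v"
proof -
  define \<mu> where "\<mu> = v \<bullet> (A *v v)"
  define q where "q u w = u \<bullet> (A *v w) - \<mu> * (u \<bullet> w)" for u w
  have nonneg: "0 \<le> q u u" if "u \<in> V" for u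
  proof (cases "u = 0")
    case False
    define e where "e = u /\<^sub>R norm u"
    have "e \<in> V" "norm e = 1" "u = norm u *\<^sub>R e"
      using False that V by (auto simp: e_def subspace_scale)
    then have "\<mu> \<le> e \<bullet> (A *v e)"
      using min by (simp add: \<mu>_def)
    moreover have "q (c *\<^sub>R e) (c *\<^sub>R e) = c\<^sup>2 * (e \<bullet> (A *v e) - \<mu>)" for c
      using \<open>norm e = 1\<close>
      by (simp add: q_def matrix_vector_mult_scaleR power2_eq_square algebra_simps norm_eq_1)
    then have "q u u = (norm u)\<^sup>2 * (e \<bullet> (A *v e) - \<mu>)"
      using \<open>u = norm u *\<^sub>R e\<close> by metis
    ultimately show ?thesis
      by simp
  qed (simp add: q_def)
  have q0: "q v v = 0"
    using v by (simp add: q_def \<mu>_def flip: power2_norm_eq_inner)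
  define w where "w = A *v v - \<mu> *\<^sub>R v"
  have wV: "w \<in> V"
    using V inv v by (simp add: w_def subspace_diff subspace_scale)
  have quad: "0 \<le> 2 * t * q w v + t\<^sup>2 * q w w" for t
  proof -
    have "0 \<le> q (v + t *\<^sub>R w) (v + t *\<^sub>R w)"
      by (intro nonneg subspace_add subspace_scale V wV v)
    also have "\<dots> = q v v + 2 * t * q w v + t\<^sup>2 * q w w"
      unfolding q_def matrix_vector_right_distrib matrix_vector_mult_scaleR inner_simps
        symmetric_dot[OF sym, of v w] inner_commute[of v w]
      by (simp add: power2_eq_square algebra_simps)
    finally show ?thesis
      using q0 by simp
  qed
  have "q w v = 0"
  proof (rule ccontr)
    assume nz: "q w v \<noteq> 0"
    \<comment> \<open>A nonnegative quadratic polynomial without constant term has no linear term: t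
      = - q(w,v) / c would make it negative. The summand 1 keeps \<open>c\<close> positive even if
      q(w,w) = 0.\<close>
    define c where "c = 1 + q w w"
    have c: "0 < c"
      using nonneg[OF wV] by (simp add: c_def)
    have "0 \<le> 2 * (- q w v / c) * q w v + (- q w v / c)\<^sup>2 * q w w"
      by (rule quad)
    also have "\<dots> = (q w v)\<^sup>2 / c\<^sup>2 * (q w w - 2 * c)"
      using c by (simp add: field_simps power2_eq_square)
    also have "\<dots> < 0"
      using nz c nonneg[OF wV] by (intro mult_pos_neg) (auto simp: c_def)
    finally show False
      by simp
  qed
  moreover have "q w v = w \<bullet> w"
    by (simp add: q_def w_def inner_simps)
  ultimately show ?thesis
    by (simp add: w_def \<mu>_def)
qed

text \<open>The quadratic form attains its minimum on the unit sphere of \<open>V\<close>, which is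
  compact and nonempty.\<close>

lemma eigenvector_in_invariant_subspace:
  fixes A :: "real^'p^'p"
  assumes sym: "symmetric A" and V: "subspace V" and inv: "\<And>u. u \<in> V \<Longrightarrow> A *v u \<in> V"
    and nz: "x \<in> V" "x \<noteq> 0"
  obtains v \<mu> where "v \<in> V" "norm v = 1" "A *v v = \<mu> *\<^sub>R v"
proof -
  have "compact (V \<inter> sphere 0 1)"
    by (intro closed_Int_compact closed_subspace V compact_sphere)
  moreover have "x /\<^sub>R norm x \<in> V \<inter> sphere 0 1"
    using nz V by (simp add: subspace_scale)
  then have "V \<inter> sphere 0 1 \<noteq> {}"
    by blast
  moreover have "continuous_on (V \<inter> sphere 0 1) (\<lambda>u. u \<bullet> (A *v u))"
    by (intro continuous_intros)
  ultimately obtain v where v: "v \<in> V \<inter> sphere 0 1"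
    "\<forall>u\<in>V \<inter> sphere 0 1. v \<bullet> (A *v v) \<le> u \<bullet> (A *v u)"
    using continuous_attains_inf[of "V \<inter> sphere 0 1" "\<lambda>u. u \<bullet> (A *v u)"] by blast
  have "A *v v = (v \<bullet> (A *v v)) *\<^sub>R v"
    by (rule eigenvector_of_minimal_quadratic_form[OF sym V inv]) (use v in auto)
  then show ?thesis
    using that v by auto
qed

text \<open>Take an orthonormal set of eigenvectors of greatest cardinality. If it did not span, its
  orthogonal complement would be nonzero and, by symmetry of \<open>A\<close>, invariant, and would
  supply one more eigenvector.\<close>

lemma orthonormal_eigenbasis_exists:
  fixes A :: "real^'p^'p"
  assumes sym: "symmetric A"
  obtains B where "finite B" "card B = CARD('p)" "pairwise orthogonal B"
    "\<And>b. b \<in> B \<Longrightarrow> norm b = 1" "\<And>b. b \<in> B \<Longrightarrow> \<exists>\<mu>. A *v b = \<mu> *\<^sub>R b"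
proof -
  define P where "P B \<longleftrightarrow> pairwise orthogonal B \<and> (\<forall>b\<in>B. norm b = 1 \<and> (\<exists>\<mu>. A *v b = \<mu> *\<^sub>R b))"
    for B :: "(real^'p) set"
  have indep: "independent B" if "P B" for B
    using that by (intro pairwise_orthogonal_independent) (auto simp: P_def)
  have "P {}"
    by (simp add: P_def)
  have "card B \<le> CARD('p)" if "P B" for B
    using independent_card_le[OF indep[OF that]] by simp
  then obtain B where PB: "P B" and maximal: "\<And>B'. P B' \<Longrightarrow> card B' \<le> card B"
    using ex_has_greatest_nat[of P "{}" card "Suc CARD('p)"] \<open>P {}\<close>
    by (meson less_Suc_eq_le)
  have fin: "finite B"
    using indep[OF PB] independent_imp_finite by blast
  have "card B = CARD('p)"
  proof (rule ccontr)
    assume "card B \<noteq> CARD('p)"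
    then have "dim B < DIM(real^'p)"
      using independent_card_le[OF indep[OF PB]] dim_eq_card_independent[OF indep[OF PB]] by simp
    then obtain x where x: "x \<noteq> 0" "\<And>y. y \<in> span B \<Longrightarrow> orthogonal x y"
      using orthogonal_to_subspace_exists by blast
    define V where "V = {x. \<forall>b\<in>B. b \<bullet> x = 0}"
    have V: "subspace V"
      by (auto simp: V_def subspace_def inner_simps)
    have inv: "A *v u \<in> V" if "u \<in> V" for u
      using that PB symmetric_dot[OF sym, of _ u] by (auto simp: V_def P_def inner_commute)
    have "x \<in> V"
      using x by (auto simp: V_def span_base orthogonal_def inner_commute)
    then obtain v \<mu> where v: "v \<in> V" "norm v = 1" "A *v v = \<mu> *\<^sub>R v"
      using eigenvector_in_invariant_subspace[OF sym V inv _ \<open>x \<noteq> 0\<close>] by blast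
    have "v \<notin> B"
      using v by (auto simp: V_def)
    moreover have "P (insert v B)"
      using PB v by (auto simp: P_def V_def pairwise_insert orthogonal_def inner_commute)
    ultimately show False
      using maximal[of "insert v B"] fin by simp
  qed
  then show ?thesis
    using that PB fin by (auto simp: P_def)
qed

lemma orthogonal_diagonalization_exists:
  fixes A :: "real^'p^'p"
  assumes "symmetric A"
  obtains Q d where "orthogonal_matrix Q" "A = Q ** diag d ** transpose Q"
proof -
  obtain B where B: "finite B" "card B = CARD('p)" "pairwise orthogonal B"
      "\<And>b. b \<in> B \<Longrightarrow> norm b = 1" "\<And>b. b \<in> B \<Longrightarrow> \<exists>\<mu>. A *v b = \<mu> *\<^sub>R b"
    using orthonormal_eigenbasis_exists[OF assms] by blast
  then obtain e where e: "bij_betw e (UNIV :: 'p set) B"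
    using finite_same_card_bij[of "UNIV :: 'p set" B] by auto
  then have eB: "e i \<in> B" for i
    by (auto simp: bij_betw_def)
  obtain \<mu> where \<mu>: "\<And>i. A *v e i = \<mu> i *\<^sub>R e i"
    using B(5)[OF eB] by metis
  define Q :: "real^'p^'p" where "Q = (\<chi> i j. e j $ i)"
  have col: "column j Q = e j" for j
    by (simp add: Q_def column_def vec_eq_iff)
  have orth: "orthogonal_matrix Q"
    unfolding orthogonal_matrix_orthonormal_columns col
  proof (intro conjI allI impI)
    show "norm (e i) = 1" for i
      using B(4) eB by blast
    show "orthogonal (e i) (e j)" if "i \<noteq> j" for i j
    proof -
      have "e i \<noteq> e j"
        using e that by (auto simp: bij_betw_def inj_eq)
      then show ?thesis
        using B(3) eB by (auto simp: pairwise_def)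
    qed
  qed
  have "A ** Q = Q ** diag (\<chi> i. \<mu> i)"
  proof -
    have "(A ** Q) $ i $ j = (A *v e j) $ i" for i j
      by (simp add: matrix_matrix_mult_def matrix_vector_mult_def Q_def)
    then show ?thesis
      by (simp add: vec_eq_iff diag_mult_right \<mu> Q_def mult.commute)
  qed
  then have "A = Q ** diag (\<chi> i. \<mu> i) ** transpose Q"
    using orth by (metis matrix_mul_assoc matrix_mul_rid orthogonal_matrix_def)
  then show ?thesis
    using that orth by blast
qed

section \<open>Spectral calculus: symmetry and eigenvectors\<close>

lemma symmetric_conjugate_diag: "symmetric (Q ** diag d ** transpose Q)"
proof -
  have "transpose (diag d) = diag d"
    by (auto simp: transpose_def diag_def vec_eq_iff)
  then show ?thesis
    by (simp add: symmetric_def matrix_transpose_mul matrix_mul_assoc)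
qed

lemma symmetric_spectral:
  assumes "symmetric A"
  shows "symmetric (spectral a A)"
proof -
  obtain Q d where "orthogonal_matrix Q" "A = Q ** diag d ** transpose Q"
    by (rule orthogonal_diagonalization_exists[OF assms])
  then show ?thesis
    by (simp add: spectral_eq symmetric_conjugate_diag)
qed

lemma diag_mult_vec: "(diag d *v w) $ i = d $ i * w $ i"
  by (simp add: matrix_vector_mult_def diag_def if_distrib[of "\<lambda>z. z * _"] cong: if_cong)

text \<open>In the coordinates w = Q^T v the eigenvalue equation is diagonal: d_i = \<mu> wherever
  w_i is nonzero, and there \<open>a\<close> can be applied to both sides.\<close>

lemma spectral_eigenvector:
  fixes A :: "real^'p^'p"
  assumes "symmetric A" and eig: "A *v v = \<mu> *\<^sub>R v"
  shows "spectral a A *v v = a \<mu> *\<^sub>R v"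
proof -
  obtain Q d where Q: "orthogonal_matrix Q" and A: "A = Q ** diag d ** transpose Q"
    by (rule orthogonal_diagonalization_exists[OF \<open>symmetric A\<close>])
  have QQ: "transpose Q ** Q = mat 1" "Q ** transpose Q = mat 1"
    using Q by (auto simp: orthogonal_matrix_def)
  define w where "w = transpose Q *v v"
  have v: "v = Q *v w"
    by (simp add: w_def matrix_vector_mul_assoc QQ del: transpose_matrix_vector)
  have "diag d *v w = transpose Q *v (A *v v)"
    by (simp add: A w_def matrix_vector_mul_assoc matrix_mul_assoc QQ del: transpose_matrix_vector)
  also have "\<dots> = \<mu> *\<^sub>R w"
    by (simp add: eig w_def matrix_vector_mult_scaleR del: transpose_matrix_vector)
  finally have "d $ i * w $ i = \<mu> * w $ i" for i
    by (metis diag_mult_vec vector_scaleR_component real_scaleR_def)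
  then have "a (d $ i) * w $ i = a \<mu> * w $ i" for i
    by (cases "w $ i = 0") auto
  then have "diag (\<chi> i. a (d $ i)) *v w = a \<mu> *\<^sub>R w"
    by (simp add: vec_eq_iff diag_mult_vec)
  moreover have "spectral a A *v v = Q *v (diag (\<chi> i. a (d $ i)) *v w)"
    unfolding A spectral_eq[OF Q]
    by (simp add: w_def matrix_vector_mul_assoc matrix_mul_assoc del: transpose_matrix_vector)
  ultimately show ?thesis
    by (simp add: v matrix_vector_mult_scaleR)
qed

section \<open>Continuity of the spectral calculus\<close>

lemma norm_orthogonal_matrix:
  fixes Q :: "real^'p^'p"
  assumes "orthogonal_matrix Q"
  shows "norm Q \<le> real CARD('p)"
proof -
  have "norm (Q $ i) = 1" for i
  proof -
    have "row i Q = Q $ i"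
      by (simp add: row_def vec_eq_iff)
    then show ?thesis
      using assms by (metis orthogonal_matrix_orthonormal_rows)
  qed
  then show ?thesis
    using L2_set_le_sum[of UNIV "\<lambda>i. norm (Q $ i)"] by (simp add: norm_vec_def)
qed

lemma compact_orthogonal_matrices: "compact {Q :: real^'p^'p. orthogonal_matrix Q}"
proof -
  have "closed {Q :: real^'p^'p. transpose Q ** Q = mat 1 \<and> Q ** transpose Q = mat 1}"
    by (intro closed_Collect_conj closed_Collect_eq continuous_intros)
  moreover have "bounded {Q :: real^'p^'p. orthogonal_matrix Q}"
    using norm_orthogonal_matrix by (auto simp: bounded_iff)
  ultimately show ?thesis
    by (simp add: compact_eq_bounded_closed orthogonal_matrix_def)
qed

text \<open>Column \<open>i\<close> of \<open>Q\<close> is a unit eigenvector for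
  \<open>d $ i\<close>, so the operator norm bounds the eigenvalue. The constant is crude; it serves
  to confine diagonals to a compact box.\<close>

lemma abs_eigenvalue_le:
  fixes Q :: "real^'p^'p"
  assumes Q: "orthogonal_matrix Q"
  shows "\<bar>d $ i\<bar> \<le> real CARD('p) * real CARD('p) * norm (Q ** diag d ** transpose Q)"
proof -
  define A where "A = Q ** diag d ** transpose Q"
  have QQ: "transpose Q ** Q = mat 1"
    using Q by (auto simp: orthogonal_matrix_def)
  have "A ** Q = Q ** diag d"
    by (simp add: A_def QQ flip: matrix_mul_assoc)
  then have "(A ** Q) $ k $ i = d $ i * Q $ k $ i" for k
    by (simp add: diag_mult_right)
  then have "A *v column i Q = d $ i *\<^sub>R column i Q"
    by (simp add: vec_eq_iff matrix_vector_mult_def matrix_matrix_mult_def column_def)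
  moreover have "norm (column i Q) = 1"
    using Q by (simp add: orthogonal_matrix_orthonormal_columns)
  ultimately have "\<bar>d $ i\<bar> \<le> onorm ((*v) A)"
    using onorm[OF matrix_vector_mul_bounded_linear, of A "column i Q"] by simp
  also have "\<dots> \<le> real CARD('p) * real CARD('p) * norm A"
    by (rule onorm_le_matrix_component) (rule order_trans[OF component_le_norm_cart Finite_Cartesian_Product.norm_nth_le])
  finally show ?thesis
    by (simp add: A_def)
qed

text \<open>On a bounded set of symmetric matrices the graph of \<^term>\<open>spectral a\<close> is the image of a
  compact set of pairs \<open>(Q, d)\<close>.\<close>

lemma continuous_on_spectral_bounded:
  fixes a :: "real \<Rightarrow> real" and R :: real
  assumes a: "continuous_on UNIV a"
  shows "continuous_on {A :: real^'p^'p. symmetric A \<and> norm A \<le> R} (spectral a)"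
proof -
  define S where "S = {A :: real^'p^'p. symmetric A \<and> norm A \<le> R}"
  define C where "C = real CARD('p) * real CARD('p) * R"
  define K where "K = {Q :: real^'p^'p. orthogonal_matrix Q} \<times> cbox (\<chi> i. - C) ((\<chi> i. C) :: real^'p)"
  define F where "F z = (fst z ** diag (snd z) ** transpose (fst z),
      fst z ** diag (\<chi> i. a (snd z $ i)) ** transpose (fst z))" for z :: "(real^'p^'p) \<times> (real^'p)"
  have contF: "continuous_on T F" for T
  proof -
    have "continuous_on T (\<lambda>z. a (snd z $ i))" for i
      by (intro continuous_on_compose2[OF a] continuous_intros) auto
    then show ?thesis
      unfolding F_def by (intro continuous_intros)
  qed
  have compF: "compact (F ` K)"
    unfolding K_def
    by (intro compact_continuous_image contF compact_Times compact_orthogonal_matrices compact_cbox)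
  have graph: "(A, spectral a A) \<in> F ` K" if AS: "A \<in> S" for A
  proof -
    obtain Q d where Q: "orthogonal_matrix Q" and A: "A = Q ** diag d ** transpose Q"
      using AS orthogonal_diagonalization_exists[of A] unfolding S_def by blast
    have "real CARD('p) * real CARD('p) * norm A \<le> C"
      using AS by (simp add: C_def S_def mult_left_mono)
    then have "\<bar>d $ i\<bar> \<le> C" for i
      using abs_eigenvalue_le[OF Q, of d i] A by simp
    then have "(Q, d) \<in> K"
      using Q by (simp add: K_def mem_box_cart abs_le_iff minus_le_iff)
    moreover have "(A, spectral a A) = F (Q, d)"
      by (simp add: F_def A spectral_eq[OF Q])
    ultimately show ?thesis
      by blast
  qed
  have graph': "B = spectral a A" if "(A, B) \<in> F ` K" for A B
    using that by (auto simp: F_def K_def spectral_eq)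
  have T: "compact (snd ` F ` K)"
    by (intro compact_continuous_image compF continuous_intros)
  have "closed S"
    unfolding S_def symmetric_def
    by (intro closed_Collect_conj closed_Collect_eq closed_Collect_le continuous_intros)
  \<comment> \<open>The box also holds diagonals of matrices with norm above \<open>R\<close>, hence
    the cut with \<open>S\<close>. A closed graph with values in a compact set gives
    continuity.\<close>
  moreover have "(\<lambda>A. (A, spectral a A)) ` S = F ` K \<inter> S \<times> UNIV"
    using graph graph' by auto
  ultimately have "closed ((\<lambda>A. (A, spectral a A)) ` S)"
    using compF by (auto intro: closed_Int compact_imp_closed closed_Times)
  moreover have "spectral a \<in> S \<rightarrow> snd ` F ` K"
  proof (rule funcsetI)
    show "spectral a A \<in> snd ` F ` K" if "A \<in> S" for A
      using imageI[OF graph[OF that], of snd] by simp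
  qed
  ultimately show ?thesis
    using continuous_from_closed_graph[OF T] by (simp add: S_def)
qed

text \<open>Continuity is local, and on a neighbourhood of each point the values of \<open>M\<close>
  are bounded, which reduces to the bounded case.\<close>

lemma continuous_on_spectral:
  fixes M :: "'a::t2_space \<Rightarrow> real^'p^'p"
  assumes a: "continuous_on UNIV a" and M: "continuous_on UNIV M" and sym: "\<And>x. symmetric (M x)"
  shows "continuous_on UNIV (\<lambda>x. spectral a (M x))"
proof -
  have "isCont (\<lambda>x. spectral a (M x)) x" for x
  proof -
    define V where "V = {y. norm (M y) < norm (M x) + 1}"
    have "open V"
      unfolding V_def by (intro open_Collect_less continuous_intros M)
    moreover have "continuous_on V (\<lambda>x. spectral a (M x))"
      by (rule continuous_on_compose2[OF continuous_on_spectral_bounded[OF a, of "norm (M x) + 1"]])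
        (use sym in \<open>auto simp: V_def intro: continuous_on_subset[OF M]\<close>)
    moreover have "x \<in> V"
      by (simp add: V_def)
    ultimately show ?thesis
      using continuous_on_eq_continuous_at by blast
  qed
  then show ?thesis
    by (simp add: continuous_on_eq_continuous_at)
qed

section \<open>Lie derivatives\<close>

text \<open>Justifies the definite description in \<open>gradient\<close>: the adjoint of the
  derivative at 1 is its Riesz representative, and that vector is unique.\<close>

lemma GDERIV_gradient:
  fixes \<phi> :: "real^'n \<Rightarrow> real"
  assumes "\<phi> differentiable (at x)"
  shows "GDERIV \<phi> x :> gradient \<phi> x"
proof -
  let ?L = "frechet_derivative \<phi> (at x)"
  have L: "(\<phi> has_derivative ?L) (at x)"
    using assms frechet_derivative_works by blast
  have "?L = (\<lambda>h. h \<bullet> adjoint ?L 1)"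
    using adjoint_works[of ?L _ 1] has_derivative_linear[OF L] by simp
  then have D: "GDERIV \<phi> x :> adjoint ?L 1"
    using L by (simp add: gderiv_def)
  have "D' = adjoint ?L 1" if "GDERIV \<phi> x :> D'" for D'
  proof -
    have "(\<lambda>h. h \<bullet> D') = (\<lambda>h. h \<bullet> adjoint ?L 1)"
      using that D has_derivative_unique unfolding gderiv_def by blast
    then show ?thesis
      by (metis vector_eq_ldot)
  qed
  then show ?thesis
    unfolding gradient_def using D by (rule theI[of "\<lambda>D. GDERIV \<phi> x :> D", rotated])
qed

text \<open>Passes from the entrywise definition to one linear map, so that linearity in the
  direction and the chain rule apply.\<close>

lemma Lie_eq_frechet_derivative:
  fixes A :: "real^'n \<Rightarrow> real^'p^'p"
  assumes "A differentiable (at x)"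
  shows "Lie w A x = frechet_derivative A (at x) (w x)"
proof -
  let ?D = "frechet_derivative A (at x)"
  have D: "(A has_derivative ?D) (at x)"
    using assms frechet_derivative_works by blast
  have "gradient (\<lambda>y. A y $ i $ j) x \<bullet> w x = ?D (w x) $ i $ j" for i j
  proof -
    have d: "((\<lambda>y. A y $ i $ j) has_derivative (\<lambda>h. ?D h $ i $ j)) (at x)"
      by (intro bounded_linear.has_derivative[OF bounded_linear_vec_nth] D)
    then have "GDERIV (\<lambda>y. A y $ i $ j) x :> gradient (\<lambda>y. A y $ i $ j) x"
      by (intro GDERIV_gradient differentiableI)
    then have "(\<lambda>h. h \<bullet> gradient (\<lambda>y. A y $ i $ j) x) = (\<lambda>h. ?D h $ i $ j)"
      using d has_derivative_unique unfolding gderiv_def by blast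
    then show ?thesis
      by (metis inner_commute)
  qed
  then show ?thesis
    by (simp add: Lie_def vec_eq_iff)
qed

lemma symmetric_Lie:
  assumes "\<And>x. symmetric (A x)"
  shows "symmetric (Lie w A x)"
proof -
  have "A y $ i $ j = A y $ j $ i" for y i j
    using assms[of y] by (simp add: symmetric_iff_nth)
  then show ?thesis
    unfolding symmetric_iff_nth Lie_def by simp
qed

lemma C_1_imp_continuous:
  assumes "C_k 1 F"
  shows "continuous_on UNIV F"
  using assms by (intro differentiable_imp_continuous_on) (simp add: differentiable_on_def)

text \<open>\<open>C_k\<close> controls derivatives in fixed directions, whereas here the direction
  moves with the point; expanding \<open>w x\<close> in the standard basis separates the
  two.\<close>

lemma continuous_on_Lie:
  fixes A :: "real^'n \<Rightarrow> real^'p^'p"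
  assumes A: "C_k 1 A" and w: "continuous_on UNIV w"
  shows "continuous_on UNIV (Lie w A)"
proof -
  have diff: "A differentiable (at x)" for x
    using A by simp
  have "Lie w A x = (\<Sum>b\<in>Basis. (w x \<bullet> b) *\<^sub>R frechet_derivative A (at x) b)" for x
  proof -
    have lin: "linear (frechet_derivative A (at x))"
      using diff linear_frechet_derivative by blast
    have "Lie w A x = frechet_derivative A (at x) (\<Sum>b\<in>Basis. (w x \<bullet> b) *\<^sub>R b)"
      by (simp add: Lie_eq_frechet_derivative diff euclidean_representation)
    also have "\<dots> = (\<Sum>b\<in>Basis. (w x \<bullet> b) *\<^sub>R frechet_derivative A (at x) b)"
      by (simp add: linear_sum[OF lin] linear_scale[OF lin])
    finally show ?thesis .
  qed
  moreover have "continuous_on UNIV (\<lambda>x. frechet_derivative A (at x) b)" for b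
    using A by simp
  ultimately show ?thesis
    using w by (auto intro!: continuous_intros)
qed

text \<open>Chain rule: the derivative is linear and g u is the sum of the columns of
  \<open>g\<close> weighted by the entries of \<open>u\<close>, which matches the terms of
  \<open>Psi_dot\<close>.\<close>

lemma Psi_dot_has_vector_derivative:
  fixes f :: "real^'n \<Rightarrow> real^'n"
  assumes diff: "Psi f H \<alpha> i differentiable (at (x t))"
    and x: "(x has_vector_derivative closed_loop f g k (x t)) (at t within T)"
  shows "((\<lambda>s. Psi f H \<alpha> i (x s)) has_vector_derivative Psi_dot f g H \<alpha> i (x t) (k (x t))) (at t within T)"
proof -
  let ?D = "frechet_derivative (Psi f H \<alpha> i) (at (x t))"
  have D: "(Psi f H \<alpha> i has_derivative ?D) (at (x t))"
    using diff frechet_derivative_works by blast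
  then have lin: "linear ?D"
    using has_derivative_linear by blast
  have "((\<lambda>s. Psi f H \<alpha> i (x s)) has_vector_derivative ?D (closed_loop f g k (x t))) (at t within T)"
    using vector_derivative_diff_chain_within[OF x has_derivative_at_withinI[OF D]]
    by (simp add: o_def)
  moreover have "?D (closed_loop f g k (x t)) = Psi_dot f g H \<alpha> i (x t) (k (x t))"
    by (simp add: closed_loop_def Psi_dot_def Lie_eq_frechet_derivative[OF diff] matrix_mult_sum
        linear_add[OF lin] linear_sum[OF lin] linear_scale[OF lin] scalar_mult_eq_scaleR)
  ultimately show ?thesis
    by simp
qed

section \<open>Comparison and invariance\<close>

text \<open>If the smallest eigenvalue were negative somewhere, take a point and a unit vector at which
  the quadratic form \<open>v \<bullet> M(t) v\<close> is minimal: the vector is an eigenvector for an eigenvalue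
  \<open>\<mu> < 0\<close>, so the form increases there at rate at least \<open>- a \<mu> > 0\<close>, and it was smaller before.
  Only monotonicity of \<open>a\<close> is used, no Lipschitz condition.\<close>

lemma pos_semidef_comparison:
  fixes M M' :: "real \<Rightarrow> real^'p^'p"
  assumes deriv: "\<And>t. t \<in> {t0..t1} \<Longrightarrow> (M has_vector_derivative M' t) (at t within {t0..t1})"
    and sym: "\<And>t. t \<in> {t0..t1} \<Longrightarrow> symmetric (M t)"
    and ineq: "\<And>t. t \<in> {t0..t1} \<Longrightarrow> - spectral a (M t) \<preceq> M' t"
    and a: "class_Ke a" and init: "pos_semidef (M t0)"
    and t: "t \<in> {t0..t1}"
  shows "pos_semidef (M t)"
proof (rule ccontr)
  assume "\<not> pos_semidef (M t)"
  then obtain u where u: "u \<bullet> (M t *v u) < 0"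
    using sym[OF t] by (auto simp: pos_semidef_def not_le)
  then have "u \<noteq> 0"
    by auto
  define q where "q z = snd z \<bullet> (M (fst z) *v snd z)" for z
  define Z where "Z = {t0..t1} \<times> sphere (0 :: real^'p) 1"
  have z0: "(t, u /\<^sub>R norm u) \<in> Z"
    using t \<open>u \<noteq> 0\<close> by (simp add: Z_def)
  have "q (t, u /\<^sub>R norm u) = (u \<bullet> (M t *v u)) / (norm u)\<^sup>2"
    by (simp add: q_def matrix_vector_mult_scaleR power2_eq_square field_simps)
  then have z0_neg: "q (t, u /\<^sub>R norm u) < 0"
    using u \<open>u \<noteq> 0\<close> by (simp add: divide_neg_pos)
  have contM: "continuous_on {t0..t1} M"
    unfolding continuous_on_eq_continuous_within
    using has_vector_derivative_continuous[OF deriv] by blast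
  have "continuous_on Z q"
    unfolding q_def
    by (intro continuous_intros continuous_on_compose2[OF contM]) (auto simp: Z_def)
  moreover have "compact Z"
    by (simp add: Z_def compact_Times)
  ultimately obtain z where "z \<in> Z" and z_min: "\<forall>y\<in>Z. q z \<le> q y"
    using continuous_attains_inf[of Z q] z0 by blast
  obtain s v where z: "z = (s, v)"
    by (cases z)
  have s: "s \<in> {t0..t1}" and v: "norm v = 1"
    using \<open>z \<in> Z\<close> by (auto simp: z Z_def)
  define \<mu> where "\<mu> = v \<bullet> (M s *v v)"
  have \<mu>: "\<mu> < 0"
    using z_min z0 z0_neg by (fastforce simp: z q_def \<mu>_def)
  have min: "\<mu> \<le> w \<bullet> (M r *v w)" if "r \<in> {t0..t1}" "norm w = 1" for r w
    using z_min that by (auto simp: z q_def \<mu>_def Z_def)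
  \<comment> \<open>Leaves room for a step back in time from the minimum.\<close>
  have "s \<noteq> t0"
    using init \<mu> unfolding pos_semidef_def \<mu>_def by (metis not_le)
  have "M s *v v = \<mu> *\<^sub>R v"
    unfolding \<mu>_def
    by (rule eigenvector_of_minimal_quadratic_form[OF sym[OF s] subspace_UNIV])
      (use v min[OF s] in \<open>auto simp: \<mu>_def\<close>)
  then have "spectral a (M s) *v v = a \<mu> *\<^sub>R v"
    by (rule spectral_eigenvector[OF sym[OF s]])
  then have "v \<bullet> (spectral a (M s) *v v) = a \<mu>"
    using v by (simp add: norm_eq_1)
  moreover have "0 \<le> v \<bullet> ((M' s + spectral a (M s)) *v v)"
    using ineq[OF s] by (simp add: loewner_le_def pos_semidef_def)
  moreover have "a \<mu> < 0"
    using a \<mu> by (metis class_Ke_def strict_monoD)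
  ultimately have rate: "0 < v \<bullet> (M' s *v v)"
    by (simp add: matrix_vector_mult_add_rdistrib inner_add_right)
  have "bounded_linear (\<lambda>A :: real^'p^'p. v \<bullet> (A *v v))"
    by (intro linear_conv_bounded_linear[THEN iffD1] linearI)
      (simp_all add: matrix_vector_mult_add_rdistrib inner_add_right scaleR_matrix_vector_assoc[symmetric])
  from bounded_linear.has_vector_derivative[OF this deriv[OF s]]
  have "((\<lambda>r. v \<bullet> (M r *v v)) has_real_derivative v \<bullet> (M' s *v v)) (at s within {t0..t1})"
    by (simp add: has_real_derivative_iff_has_vector_derivative)
  \<comment> \<open>The vector \<open>v\<close> stays fixed while time moves back, so no derivative
    of an eigenvalue enters. Looking only to the left of \<open>s\<close> also covers s =
    t1.\<close>
  from has_real_derivative_pos_inc_left[OF this rate] obtain d where "0 < d"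
    and d: "\<And>h. 0 < h \<Longrightarrow> s - h \<in> {t0..t1} \<Longrightarrow> h < d \<Longrightarrow> v \<bullet> (M (s - h) *v v) < \<mu>"
    by (auto simp: \<mu>_def)
  \<comment> \<open>Halving makes \<open>h\<close> strictly smaller than \<open>d\<close>; the other
    bound keeps s - h in the time interval.\<close>
  define h where "h = min (d / 2) (s - t0)"
  have "0 < h" "h < d" "s - h \<in> {t0..t1}"
    using \<open>0 < d\<close> s \<open>s \<noteq> t0\<close> by (auto simp: h_def min_def)
  then show False
    using d[of h] min[of "s - h" v] v by simp
qed

section \<open>Positivity along trajectories and invariance of the safe sets\<close>

lemma symmetric_Psi:
  assumes "\<And>x. symmetric (H x)"
  shows "symmetric (Psi f H \<alpha> i x)"
  using assms
  by (induction i arbitrary: x) (auto intro: symmetric_add symmetric_Lie symmetric_spectral)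

lemma symmetric_Psi_dot:
  assumes "\<And>x. symmetric (H x)"
  shows "symmetric (Psi_dot f g H \<alpha> i x u)"
  unfolding Psi_dot_def
  by (intro symmetric_add symmetric_sum symmetric_scaleR symmetric_Lie symmetric_Psi assms)

lemma closed_pos_semidef: "closed {A :: real^'p^'p. pos_semidef A}"
  unfolding pos_semidef_def symmetric_def
  by (intro closed_Collect_conj closed_Collect_all closed_Collect_eq closed_Collect_le
      continuous_intros)

lemma closed_safe_set:
  assumes "C_k 1 (Psi f H \<alpha> i)"
  shows "closed (safe_set f H \<alpha> i)"
proof -
  have "safe_set f H \<alpha> i = Psi f H \<alpha> i -` {A. pos_semidef A}"
    by (auto simp: safe_set_def loewner_le_def)
  then show ?thesis
    using closed_vimage[OF closed_pos_semidef C_1_imp_continuous[OF assms]] by simp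
qed

lemma pos_semidef_Psi_along_trajectory:
  fixes f :: "real^'n \<Rightarrow> real^'n" and g :: "real^'n \<Rightarrow> real^'m^'n" and H :: "real^'n \<Rightarrow> real^'p^'p"
  assumes sym: "\<And>x. symmetric (H x)"
    and Ke: "\<And>i. i \<in> {1..<r} \<Longrightarrow> class_Ke (\<alpha> i)"
    and C1: "\<And>i. i \<in> {1..r} \<Longrightarrow> C_k 1 (Psi f H \<alpha> i)"
    and first: "first_actuated_level f g H \<alpha> r"
    and ar: "class_Ke ar"
    and traj: "trajectory (closed_loop f g k) {t0..t1} x"
    and ineq: "\<And>t. t \<in> {t0..t1} \<Longrightarrow>
      - spectral ar (Psi f H \<alpha> r (x t)) \<preceq> Psi_dot f g H \<alpha> r (x t) (k (x t))"
    and init: "\<And>i. i \<in> {1..r} \<Longrightarrow> pos_semidef (Psi f H \<alpha> i (x t0))"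
    and i: "1 \<le> i" "i \<le> r" and t: "t \<in> {t0..t1}"
  shows "pos_semidef (Psi f H \<alpha> i (x t))"
  using \<open>i \<le> r\<close> i(1) t
\<comment> \<open>The induction runs downwards from \<open>r\<close>. The time is generalized
  because the comparison at one level needs positivity of the next level on the whole
  interval.\<close>
proof (induction i arbitrary: t rule: inc_induct)
  have deriv: "((\<lambda>s. Psi f H \<alpha> j (x s)) has_vector_derivative
      Psi_dot f g H \<alpha> j (x s) (k (x s))) (at s within {t0..t1})" if "j \<in> {1..r}" "s \<in> {t0..t1}" for j s
    using that C1 traj by (intro Psi_dot_has_vector_derivative) (auto simp: trajectory_def)
  {
    case base
    show ?case
    proof (rule pos_semidef_comparison[OF deriv _ ineq ar _ base(2)])
      show "pos_semidef (Psi f H \<alpha> r (x t0))"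
        using base(1) init by simp
    qed (use base(1) in \<open>auto intro: symmetric_Psi sym\<close>)
  next
    case (step j)
    have j: "j \<in> {1..<r}"
      using step by simp
    \<comment> \<open>Below level \<open>r\<close> all input terms vanish, and j \<ge> 1 selects the
      recursive branch of \<open>Psi\<close>. The required inequality is then positivity of level
      \<open>Suc j\<close>.\<close>
    then have dot: "Psi_dot f g H \<alpha> j y u = Psi f H \<alpha> (Suc j) y - spectral (\<alpha> j) (Psi f H \<alpha> j y)" for y u
      using first by (simp add: Psi_dot_def first_actuated_level_def)
    have ineq_j: "- spectral (\<alpha> j) (Psi f H \<alpha> j (x s)) \<preceq> Psi_dot f g H \<alpha> j (x s) (k (x s))"
      if "s \<in> {t0..t1}" for s
      using step.IH[of s] that by (simp add: dot loewner_le_def del: Psi.simps)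
    show ?case
    proof (rule pos_semidef_comparison[OF deriv _ ineq_j _ _ step.prems(2)])
      show "pos_semidef (Psi f H \<alpha> j (x t0))"
        using j init by simp
    qed (use j Ke in \<open>auto intro: symmetric_Psi sym\<close>)
  }
qed

text \<open>Reduces invariance to trajectory pieces that stay in a neighbourhood of
  \<open>S\<close>, where the differential inequality is available; it argues about each given
  solution separately.\<close>

lemma forward_invariant_of_local:
  assumes S: "closed S"
    and local: "\<And>x t0 t1. trajectory F {t0..t1} x \<Longrightarrow> x t0 \<in> S \<Longrightarrow> t0 \<le> t1 \<Longrightarrow> x ` {t0..t1} \<subseteq> U \<Longrightarrow> x t1 \<in> S"
    and U: "open U" "S \<subseteq> U"
  shows "forward_invariant F S"
  unfolding forward_invariant_def
proof (intro allI impI ballI)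
  fix J :: "real set" and x t
  assume "is_interval J \<and> 0 \<in> J \<and> J \<subseteq> {0..} \<and> trajectory F J x \<and> x 0 \<in> S" and t: "t \<in> J"
  then have J: "is_interval J" "0 \<in> J" "J \<subseteq> {0..}" and traj: "trajectory F J x" and init: "x 0 \<in> S"
    by auto
  have "0 \<le> t"
    using t J by auto
  have sub: "{0..t} \<subseteq> J"
    using mem_is_interval_1_I[OF J(1,2) t] by auto
  have traj_sub: "trajectory F T x" if "T \<subseteq> {0..t}" for T
  proof -
    have "T \<subseteq> J"
      using that sub by blast
    then show ?thesis
      using traj has_vector_derivative_within_subset unfolding trajectory_def by blast
  qed
  have cont: "continuous_on {0..t} x"
    using traj_sub[OF order_refl] has_vector_derivative_continuous
    unfolding trajectory_def continuous_on_eq_continuous_within by blast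
  define T where "T = {s \<in> {0..t}. x s \<in> S}"
  have "T = {0..t} \<inter> x -` S"
    by (auto simp: T_def)
  then have "compact T"
    using continuous_closed_preimage[OF cont closed_atLeastAtMost S]
    by (metis bounded_Int bounded_closed_interval compact_eq_bounded_closed)
  moreover have "0 \<in> T"
    using init \<open>0 \<le> t\<close> by (simp add: T_def)
  ultimately obtain t0 where t0: "t0 \<in> T" and last: "\<And>s. s \<in> T \<Longrightarrow> s \<le> t0"
    using compact_attains_sup[of T] by blast
  have "t0 = t"
  proof (rule ccontr)
    assume "t0 \<noteq> t"
    then have "t0 < t"
      using t0 by (simp add: T_def)
    have "x t0 \<in> U"
      using t0 U by (auto simp: T_def)
    then obtain e where "0 < e" and e: "ball (x t0) e \<subseteq> U"
      using U openE by blast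
    obtain d where "0 < d" and d: "\<And>s. s \<in> {0..t} \<Longrightarrow> dist s t0 < d \<Longrightarrow> dist (x s) (x t0) < e"
      using cont t0 \<open>0 < e\<close> unfolding continuous_on_iff T_def by blast
    \<comment> \<open>A time after the supposed last visit, close enough that the trajectory is
      still in \<open>U\<close>; \<open>local\<close> then yields a later visit to
      \<open>S\<close>.\<close>
    define t1 where "t1 = min t (t0 + d / 2)"
    have t1: "t0 < t1" "t1 \<le> t" "t1 \<le> t0 + d / 2"
      using \<open>0 < d\<close> \<open>t0 < t\<close> by (auto simp: t1_def)
    have "0 \<le> t0"
      using t0 by (simp add: T_def)
    have "x s \<in> U" if "s \<in> {t0..t1}" for s
    proof -
      have "dist (x s) (x t0) < e"
        using that t1 \<open>0 < d\<close> \<open>0 \<le> t0\<close> by (intro d) (auto simp: dist_real_def)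
      then show ?thesis
        using e by (auto simp: dist_commute)
    qed
    then have "x t1 \<in> S"
      using t1 t0 \<open>0 \<le> t0\<close> by (intro local[of t0 t1 x] traj_sub) (auto simp: T_def)
    then have "t1 \<in> T"
      using t1 \<open>0 \<le> t0\<close> by (simp add: T_def)
    then show False
      using last[of t1] t1 by simp
  qed
  then show "x t \<in> S"
    using t0 by (simp add: T_def)
qed

lemma safe_sets_forward_invariant:
  fixes f :: "real^'n \<Rightarrow> real^'n" and g :: "real^'n \<Rightarrow> real^'m^'n" and H :: "real^'n \<Rightarrow> real^'p^'p"
  assumes sym: "\<And>x. symmetric (H x)"
    and Ke: "\<And>i. i \<in> {1..<r} \<Longrightarrow> class_Ke (\<alpha> i)"
    and C1: "\<And>i. i \<in> {1..r} \<Longrightarrow> C_k 1 (Psi f H \<alpha> i)"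
    and first: "first_actuated_level f g H \<alpha> r"
    and ar: "class_Ke ar"
    and U: "open U" "(\<Inter>i\<in>{1..r}. safe_set f H \<alpha> i) \<subseteq> U"
    and ineq: "\<And>x. x \<in> U \<Longrightarrow> - spectral ar (Psi f H \<alpha> r x) \<preceq> Psi_dot f g H \<alpha> r x (k x)"
  shows "forward_invariant (closed_loop f g k) (\<Inter>i\<in>{1..r}. safe_set f H \<alpha> i)"
proof (rule forward_invariant_of_local[OF _ _ U])
  show "closed (\<Inter>i\<in>{1..r}. safe_set f H \<alpha> i)"
    using C1 closed_safe_set by (intro closed_INT) blast
next
  fix x t0 t1
  assume traj: "trajectory (closed_loop f g k) {t0..t1} x"
    and init: "x t0 \<in> (\<Inter>i\<in>{1..r}. safe_set f H \<alpha> i)" and t: "t0 \<le> t1" and xU: "x ` {t0..t1} \<subseteq> U"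
  have "pos_semidef (Psi f H \<alpha> i (x t1))" if "i \<in> {1..r}" for i
    by (rule pos_semidef_Psi_along_trajectory[OF sym Ke C1 first ar traj])
      (use init t that xU ineq in \<open>auto simp: safe_set_def loewner_le_def image_subset_iff\<close>)
  then show "x t1 \<in> (\<Inter>i\<in>{1..r}. safe_set f H \<alpha> i)"
    by (auto simp: safe_set_def loewner_le_def)
qed

section \<open>Continuity of the projection controller\<close>

text \<open>A symmetric matrix fails to be positive definite exactly when some unit vector has a
  nonpositive form value. Such matrices form the projection of a closed set along the compact
  sphere, hence a closed set.\<close>

lemma open_pos_def_vimage:
  fixes M :: "'a::topological_space \<Rightarrow> real^'p^'p"
  assumes M: "continuous_on UNIV M" and sym: "\<And>x. symmetric (M x)"
  shows "open {x. pos_def (M x)}"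
proof -
  let ?T = "{z :: (real^'p) \<times> (real^'p^'p). fst z \<bullet> (snd z *v fst z) \<le> 0}"
  let ?N = "{A :: real^'p^'p. \<exists>v. v \<in> sphere 0 1 \<and> (v, A) \<in> ?T}"
  have "closed ?T"
    by (intro closed_Collect_le continuous_intros)
  then have "closed ?N"
    by (rule closed_compact_projection[OF compact_sphere])
  then have "open (M -` (- ?N))"
    by (intro open_vimage M open_Compl)
  moreover have "pos_def (M x) \<longleftrightarrow> M x \<notin> ?N" for x
  proof
    assume pos: "pos_def (M x)"
    have "0 < v \<bullet> (M x *v v)" if "v \<in> sphere 0 1" for v
    proof -
      have "v \<noteq> 0"
        using that by auto
      then show ?thesis
        using pos by (simp add: pos_def_def)
    qed
    then show "M x \<notin> ?N"
      by (auto simp: not_le[symmetric])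
  next
    assume N: "M x \<notin> ?N"
    have "0 < v \<bullet> (M x *v v)" if "v \<noteq> 0" for v
    proof -
      have "0 < w \<bullet> (M x *v w)" if "norm w = 1" for w
        using N that by (auto simp: not_le)
      from this[of "v /\<^sub>R norm v"] have "0 < (v /\<^sub>R norm v) \<bullet> (M x *v (v /\<^sub>R norm v))"
        using that by simp
      also have "\<dots> = (v \<bullet> (M x *v v)) / (norm v)\<^sup>2"
        by (simp add: matrix_vector_mult_scaleR power2_eq_square field_simps)
      finally show ?thesis
        using that by (simp add: zero_less_divide_iff)
    qed
    then show "pos_def (M x)"
      using sym by (simp add: pos_def_def)
  qed
  ultimately show ?thesis
    by (simp add: vimage_def)
qed

section \<open>Convexity of the constraint and Slater points\<close>

lemma pos_def_imp_pos_semidef: "pos_def A \<Longrightarrow> pos_semidef A"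
  unfolding pos_def_def pos_semidef_def
  by (metis inner_zero_left less_imp_le order_refl)

lemma pos_semidef_convex_comb:
  assumes "pos_semidef A" "pos_semidef B" "0 \<le> t" "t \<le> 1"
  shows "pos_semidef ((1 - t) *\<^sub>R A + t *\<^sub>R B)"
  using assms
  by (auto simp: pos_semidef_def matrix_vector_mult_add_rdistrib inner_add_right
      scaleR_matrix_vector_assoc[symmetric] intro!: symmetric_add symmetric_scaleR)

text \<open>Any positive step from a feasible point towards a Slater point is already strictly
  feasible, since the second form contributes a positive amount.\<close>

lemma pos_def_convex_comb:
  assumes "pos_semidef A" "pos_def B" "0 < t" "t \<le> 1"
  shows "pos_def ((1 - t) *\<^sub>R A + t *\<^sub>R B)"
  using assms
  by (auto simp: pos_def_def pos_semidef_def matrix_vector_mult_add_rdistrib inner_add_right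
      scaleR_matrix_vector_assoc[symmetric] intro!: symmetric_add symmetric_scaleR add_nonneg_pos)

text \<open>Isolates the quadratic program from the control system: \<open>G\<close> is the
  constraint matrix, affine in the input, \<open>c\<close> the nominal input, and \<open>U\<close>
  the set of states satisfying Slater's condition.\<close>

locale slater_projection =
  fixes G :: "real^'n \<Rightarrow> real^'m \<Rightarrow> real^'p^'p" and c :: "real^'n \<Rightarrow> real^'m"
    and U :: "(real^'n) set" and k :: "real^'n \<Rightarrow> real^'m"
  assumes contG: "continuous_on UNIV (\<lambda>z. G (fst z) (snd z))"
    and symG: "\<And>x u. symmetric (G x u)"
    and affG: "\<And>x u w t. G x ((1 - t) *\<^sub>R u + t *\<^sub>R w) = (1 - t) *\<^sub>R G x u + t *\<^sub>R G x w"
    and contc: "continuous_on UNIV c"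
    and U_def: "U = {x. \<exists>u. pos_def (G x u)}"
    and k_def: "\<And>x. k x = (ARG_MIN (\<lambda>u. (norm (u - c x))\<^sup>2) u. pos_semidef (G x u))"
begin

lemma continuous_on_slice: "continuous_on UNIV (\<lambda>x. G x u)"
  using continuous_on_compose2[OF contG continuous_on_Pair[OF continuous_on_id continuous_on_const]]
  by simp

lemma open_U: "open U"
proof -
  have "U = (\<Union>u. {x. pos_def (G x u)})"
    by (auto simp: U_def)
  then show ?thesis
    by (auto intro!: open_UN open_pos_def_vimage continuous_on_slice symG)
qed

text \<open>Puts the program in nearest-point form, suited to projection onto a closed convex
  set.\<close>

lemma is_arg_min_iff:
  "is_arg_min (\<lambda>u. (norm (u - c x))\<^sup>2) (\<lambda>u. pos_semidef (G x u)) u \<longleftrightarrow>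
     pos_semidef (G x u) \<and> (\<forall>w. pos_semidef (G x w) \<longrightarrow> dist (c x) u \<le> dist (c x) w)"
  by (simp add: is_arg_min_linorder dist_norm norm_minus_commute)

text \<open>The feasible set is nonempty by Slater's condition, closed by continuity and convex by
  affinity in the input, so the nearest point exists and is unique.\<close>

lemma ex1_arg_min:
  assumes "x \<in> U"
  shows "\<exists>!u. is_arg_min (\<lambda>u. (norm (u - c x))\<^sup>2) (\<lambda>u. pos_semidef (G x u)) u"
proof -
  define F where "F = {u. pos_semidef (G x u)}"
  have "F \<noteq> {}"
    using assms pos_def_imp_pos_semidef by (auto simp: U_def F_def)
  have "continuous_on UNIV (G x)"
    using continuous_on_compose2[OF contG continuous_on_Pair[OF continuous_on_const continuous_on_id]]
    by simp
  then have "closed F"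
    using closed_vimage[OF closed_pos_semidef, of "G x"] by (simp add: F_def vimage_def)
  have "convex F"
    unfolding convex_alt by (auto simp: F_def affG intro: pos_semidef_convex_comb)
  show ?thesis
    unfolding is_arg_min_iff
    using closest_point_exists[OF \<open>closed F\<close> \<open>F \<noteq> {}\<close>, of "c x"]
      any_closest_point_unique[OF \<open>convex F\<close> \<open>closed F\<close>, of _ _ "c x"]
    unfolding F_def mem_Collect_eq by (intro ex_ex1I) blast+
qed

lemma k_is_arg_min:
  assumes "x \<in> U"
  shows "is_arg_min (\<lambda>u. (norm (u - c x))\<^sup>2) (\<lambda>u. pos_semidef (G x u)) (k x)"
  using ex1_implies_ex[OF ex1_arg_min[OF assms]] unfolding k_def arg_min_def by (rule someI_ex)

text \<open>By Slater's condition it suffices to compare with strictly feasible competitors; being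
  strictly feasible is an open condition, so this describes the graph of \<open>k\<close> by closed conditions.\<close>

lemma k_eq_iff:
  assumes "x \<in> U"
  shows "u = k x \<longleftrightarrow>
    pos_semidef (G x u) \<and> (\<forall>w. \<not> pos_def (G x w) \<or> dist (c x) u \<le> dist (c x) w)"
proof
  assume "u = k x"
  then show "pos_semidef (G x u) \<and> (\<forall>w. \<not> pos_def (G x w) \<or> dist (c x) u \<le> dist (c x) w)"
    using k_is_arg_min[OF assms] pos_def_imp_pos_semidef unfolding is_arg_min_iff by blast
next
  assume u: "pos_semidef (G x u) \<and> (\<forall>w. \<not> pos_def (G x w) \<or> dist (c x) u \<le> dist (c x) w)"
  obtain s where s: "pos_def (G x s)"
    using assms by (auto simp: U_def)
  have "dist (c x) u \<le> dist (c x) w" if w: "pos_semidef (G x w)" for w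
  proof -
    have "dist (c x) u \<le> dist (c x) ((1 - t) *\<^sub>R w + t *\<^sub>R s)" if "t \<in> {0<..1}" for t
      using u pos_def_convex_comb[OF w s, of t] that by (auto simp flip: affG)
    \<comment> \<open>A merely feasible \<open>w\<close> is approached along the segment from the
      Slater point \<open>s\<close>; the inequality survives the limit.\<close>
    then have "\<forall>\<^sub>F t in at_right 0. dist (c x) u \<le> dist (c x) ((1 - t) *\<^sub>R w + t *\<^sub>R s)"
      unfolding eventually_at_right_field by (intro exI[of _ 1]) auto
    moreover have "((\<lambda>t. dist (c x) ((1 - t) *\<^sub>R w + t *\<^sub>R s)) \<longlongrightarrow>
        dist (c x) ((1 - 0) *\<^sub>R w + 0 *\<^sub>R s)) (at_right 0)"
      by (intro tendsto_intros)
    ultimately show ?thesis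
      using tendsto_lowerbound trivial_limit_at_right_real by fastforce
  qed
  then have "is_arg_min (\<lambda>u. (norm (u - c x))\<^sup>2) (\<lambda>u. pos_semidef (G x u)) u"
    using u by (simp add: is_arg_min_iff)
  then show "u = k x"
    using ex1_arg_min[OF assms] k_is_arg_min[OF assms] by blast
qed

lemma continuous_on_k: "continuous_on U k"
proof -
  have "isCont k x0" if x0: "x0 \<in> U" for x0
  proof -
    obtain s where s: "pos_def (G x0 s)"
      using x0 by (auto simp: U_def)
    define V where "V = {x. pos_def (G x s)} \<inter> {x. norm (c x) < norm (c x0) + 1}"
    have "open V"
      unfolding V_def
      by (intro open_Int open_pos_def_vimage open_Collect_less continuous_intros continuous_on_slice
          symG contc)
    have "x0 \<in> V"
      using s by (simp add: V_def)
    have VU: "V \<subseteq> U"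
      by (auto simp: V_def U_def)
    \<comment> \<open>The input \<open>s\<close> stays feasible on \<open>V\<close>, so k(x) is at
      least as close to c(x) as \<open>s\<close>. The triangle inequality and the bound on
      \<open>c\<close> over \<open>V\<close> give \<open>R\<close>.\<close>
    define R where "R = norm s + 2 * (norm (c x0) + 1)"
    have "norm (k x) \<le> R" if "x \<in> V" for x
    proof -
      have "dist (c x) (k x) \<le> dist (c x) s"
        using k_eq_iff[of x "k x"] that VU by (auto simp: V_def)
      then have "norm (k x) \<le> norm s + 2 * norm (c x)"
        unfolding dist_norm by norm
      then show ?thesis
        using that by (simp add: V_def R_def)
    qed
    then have kR: "k \<in> V \<rightarrow> cball 0 R"
      by auto
    \<comment> \<open>The conditions of \<open>k_eq_iff\<close> as a closed set of pairs; over
      \<open>V\<close> it is the graph of \<open>k\<close>, which together with compactness of the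
      ball gives continuity.\<close>
    define T where "T = {z. pos_semidef (G (fst z) (snd z))} \<inter>
      (\<Inter>w. {z. \<not> pos_def (G (fst z) w)} \<union> {z. dist (c (fst z)) (snd z) \<le> dist (c (fst z)) w})"
    have contc': "continuous_on UNIV (\<lambda>z. c (fst z))"
      by (rule continuous_on_compose2[OF contc]) (auto intro: continuous_intros)
    have "closed {z. \<not> pos_def (G (fst z) w)}" for w
    proof -
      have "continuous_on UNIV (\<lambda>z. G (fst z) w)"
        by (rule continuous_on_compose2[OF continuous_on_slice]) (auto intro: continuous_intros)
      then have "open {z. pos_def (G (fst z) w)}"
        by (rule open_pos_def_vimage) (rule symG)
      then show ?thesis
        by (simp add: closed_def Compl_eq)
    qed
    moreover have "closed {z. dist (c (fst z)) (snd z) \<le> dist (c (fst z)) w}" for w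
      by (intro closed_Collect_le continuous_intros contc')
    moreover have "closed {z. pos_semidef (G (fst z) (snd z))}"
      using closed_vimage[OF closed_pos_semidef contG] by (simp add: vimage_def)
    ultimately have "closed T"
      unfolding T_def by (intro closed_Int closed_INT closed_Un ballI)
    moreover have "(\<lambda>x. (x, k x)) ` V = V \<times> cball 0 R \<inter> T"
    proof -
      have "(x, u) \<in> T \<longleftrightarrow> u = k x" if "x \<in> V" for x u
        using k_eq_iff[of x u] that VU by (auto simp: T_def)
      then show ?thesis
        using kR by auto
    qed
    ultimately have "closedin (top_of_set (V \<times> cball 0 R)) ((\<lambda>x. (x, k x)) ` V)"
      by (metis closedin_closed)
    then have "continuous_on V k"
      using continuous_closed_graph_eq[OF compact_cball kR] by blast
    then show ?thesis
      using \<open>open V\<close> \<open>x0 \<in> V\<close> continuous_on_eq_continuous_at by blast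
  qed
  then show ?thesis
    by (simp add: continuous_at_imp_continuous_on)
qed

end

section \<open>Application to the control system\<close>

lemma continuous_on_column [continuous_intros]:
  fixes A :: "'a::topological_space \<Rightarrow> real^'n^'m"
  assumes "continuous_on S A"
  shows "continuous_on S (\<lambda>x. column j (A x))"
  unfolding column_def by (intro continuous_intros assms)

lemma smooth_imp_continuous: "smooth F \<Longrightarrow> continuous_on UNIV F"
  by (metis C_k.simps(1) smooth_def)

theorem theorem1:
  fixes f :: "real^'n \<Rightarrow> real^'n"
    and g :: "real^'n \<Rightarrow> real^'m^'n"
    and H :: "real^'n \<Rightarrow> real^'p^'p"
    and \<alpha> :: "nat \<Rightarrow> real \<Rightarrow> real"
    and ar :: "real \<Rightarrow> real"
    and r :: nat
  assumes "smooth f" and "smooth g" and "smooth H"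
    and "\<forall>x. symmetric (H x)"
    and "\<forall>i\<in>{1..<r}. class_Ke (\<alpha> i)"
    and "\<forall>i\<in>{1..r}. C_k 1 (Psi f H \<alpha> i)"
    and "first_actuated_level f g H \<alpha> r"
    and "HOMCBF_with f g H \<alpha> r ar"
  shows
    "(\<forall>k. continuous_on UNIV k \<and>
          (\<exists>U. open U \<and> (\<Inter>i\<in>{1..r}. safe_set f H \<alpha> i) \<subseteq> U \<and>
               (\<forall>x\<in>U. - spectral ar (Psi f H \<alpha> r x) \<preceq> Psi_dot f g H \<alpha> r x (k x)))
        \<longrightarrow> forward_invariant (closed_loop f g k) (\<Inter>i\<in>{1..r}. safe_set f H \<alpha> i))
     \<and>
     (\<forall>k_nom k. continuous_on UNIV k_nom \<and>
          (\<forall>x. k x = (ARG_MIN (\<lambda>u. (norm (u - k_nom x))\<^sup>2) u.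
                         - spectral ar (Psi f H \<alpha> r x) \<preceq> Psi_dot f g H \<alpha> r x u))
        \<longrightarrow> (\<exists>U. open U \<and> (\<Inter>i\<in>{1..r}. safe_set f H \<alpha> i) \<subseteq> U \<and>
               (\<forall>x\<in>U. \<exists>!u. is_arg_min (\<lambda>u. (norm (u - k_nom x))\<^sup>2)
                   (\<lambda>u. - spectral ar (Psi f H \<alpha> r x) \<preceq> Psi_dot f g H \<alpha> r x u) u) \<and>
               continuous_on U k)
          \<and> forward_invariant (closed_loop f g k) (\<Inter>i\<in>{1..r}. safe_set f H \<alpha> i))"
proof -
  let ?S = "\<Inter>i\<in>{1..r}. safe_set f H \<alpha> i"
  have sym: "symmetric (H x)" for x
    using assms(4) by blast
  have Ke: "class_Ke (\<alpha> i)" if "i \<in> {1..<r}" for i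
    using assms(5) that by blast
  have C1: "C_k 1 (Psi f H \<alpha> i)" if "i \<in> {1..r}" for i
    using assms(6) that by blast
  have ar: "class_Ke ar"
    using assms(8) by (simp add: HOMCBF_with_def)
  have "1 \<le> r"
    using assms(7) by (simp add: first_actuated_level_def)
  then have C1r: "C_k 1 (Psi f H \<alpha> r)"
    by (intro C1) simp
  \<comment> \<open>Used for both claims: with the given neighbourhood in the first, with the Slater
    points in the second.\<close>
  have invariant: "forward_invariant (closed_loop f g k) ?S"
    if "open U" "?S \<subseteq> U"
      and "\<And>x. x \<in> U \<Longrightarrow> - spectral ar (Psi f H \<alpha> r x) \<preceq> Psi_dot f g H \<alpha> r x (k x)" for U k
    by (rule safe_sets_forward_invariant[OF sym Ke C1 assms(7) ar that])
  have qp: "(\<exists>U. open U \<and> ?S \<subseteq> U \<and>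
      (\<forall>x\<in>U. \<exists>!u. is_arg_min (\<lambda>u. (norm (u - k_nom x))\<^sup>2)
        (\<lambda>u. - spectral ar (Psi f H \<alpha> r x) \<preceq> Psi_dot f g H \<alpha> r x u) u) \<and>
      continuous_on U k) \<and> forward_invariant (closed_loop f g k) ?S"
    if k_nom: "continuous_on UNIV k_nom"
      and k: "\<And>x. k x = (ARG_MIN (\<lambda>u. (norm (u - k_nom x))\<^sup>2) u.
        - spectral ar (Psi f H \<alpha> r x) \<preceq> Psi_dot f g H \<alpha> r x u)" for k_nom k
  proof -
    \<comment> \<open>With the spectral term moved across, the constraint reads
      \<open>pos_semidef (G x u)\<close>, and the strict HOMCBF inequality says that every point of
      the intersection lies in \<open>U\<close>.\<close>
    define G where "G x u = Psi_dot f g H \<alpha> r x u + spectral ar (Psi f H \<alpha> r x)" for x u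
    define U where "U = {x. \<exists>u. pos_def (G x u)}"
    have feasible: "- spectral ar (Psi f H \<alpha> r x) \<preceq> Psi_dot f g H \<alpha> r x u \<longleftrightarrow> pos_semidef (G x u)"
      for x u
      by (simp add: loewner_le_def G_def)
    interpret slater_projection G k_nom U k
    proof
      have fst: "continuous_on UNIV (\<lambda>z :: (real^'n) \<times> (real^'m). F (fst z))"
        if "continuous_on UNIV F" for F :: "real^'n \<Rightarrow> real^'p^'p"
        by (rule continuous_on_compose2[OF that continuous_on_fst[OF continuous_on_id]]) simp
      have "continuous_on UNIV (\<lambda>x. spectral ar (Psi f H \<alpha> r x))"
        using ar unfolding class_Ke_def
        by (intro continuous_on_spectral[of ar] C_1_imp_continuous[OF C1r] symmetric_Psi sym) simp
      moreover have "continuous_on UNIV (Lie f (Psi f H \<alpha> r))"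
        by (intro continuous_on_Lie C1r smooth_imp_continuous assms)
      moreover have "continuous_on UNIV (Lie (\<lambda>y. column j (g y)) (Psi f H \<alpha> r))" for j
        by (intro continuous_on_Lie C1r continuous_intros smooth_imp_continuous assms)
      ultimately show "continuous_on UNIV (\<lambda>z. G (fst z) (snd z))"
        unfolding G_def Psi_dot_def
        by (intro continuous_intros fst)
      show "symmetric (G x u)" for x u
        unfolding G_def by (intro symmetric_add symmetric_Psi_dot symmetric_spectral symmetric_Psi sym)
      show "G x ((1 - t) *\<^sub>R u + t *\<^sub>R w) = (1 - t) *\<^sub>R G x u + t *\<^sub>R G x w" for x u w t
        by (simp add: G_def Psi_dot_def algebra_simps sum.distrib sum_subtractf scaleR_sum_right)
    qed (use k_nom k in \<open>simp_all add: U_def feasible\<close>)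
    have SU: "?S \<subseteq> U"
      using assms(8) by (simp add: HOMCBF_with_def U_def G_def loewner_less_def subset_iff)
    have "- spectral ar (Psi f H \<alpha> r x) \<preceq> Psi_dot f g H \<alpha> r x (k x)" if "x \<in> U" for x
      using k_is_arg_min[OF that] by (simp add: feasible is_arg_min_iff)
    then have "forward_invariant (closed_loop f g k) ?S"
      by (rule invariant[OF open_U SU])
    then show ?thesis
      unfolding feasible
      by (intro conjI exI[of _ U] ballI open_U SU ex1_arg_min continuous_on_k)
  qed
  show ?thesis
  proof (rule conjI; intro allI impI; elim conjE exE)
    fix k U
    assume "open U" "?S \<subseteq> U"
      and "\<forall>x\<in>U. - spectral ar (Psi f H \<alpha> r x) \<preceq> Psi_dot f g H \<alpha> r x (k x)"
    then show "forward_invariant (closed_loop f g k) ?S"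
      using invariant by simp
  qed (rule qp; blast)
qed

end
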